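(* Let $d\ge 1$ and $n\ge 1$ be integers, and let $\mathcal{P}_0,\mathcal{P}_1,\ldots,\mathcal{P}_n\subset\mathbb{R}^d$ be polytopes. Suppose that all $\mathcal{P}_i$, $i\in\{0,1,\ldots,n\}$, are nonempty and that at least one of them is full dimensional (in $\mathbb{R}^d$). Then the polytope $$\mathcal{D}:=\operatorname{conv}\left(\bigcup_{i=0}^n\left\{\begin{pmatrix}x\\ \mathbf{e}_i\end{pmatrix} : x\in\mathcal{P}_i\right\}\right)\subset\mathbb{R}^{d+n}$$ is full dimensional (in $\mathbb{R}^{d+n}$).
   Context: $\mathbf{e}_i$ denotes the $i$-th standard unit vector of $\mathbb{R}^n$ for $i\in\{1,\ldots,n\}$, and $\mathbf{e}_0$ denotes the zero vector of $\mathbb{R}^n$. Points of $\mathbb{R}^{d+n}$ are written $\begin{pmatrix}x\\ z\end{pmatrix}$ with $x\in\mathbb{R}^d$, $z\in\mathbb{R}^n$. The dimension of a polytope is one less than the maximum number of affinely independent points in it; a polytope in $\mathbb{R}^m$ is full dimensional if its dimension is $m$. *)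

theory Defs
  imports "HOL-Analysis.Analysis"
begin

(* The index set {0, ..., n} is 'n option with CARD('n) = n: None plays the role of 0 and
   Some i ranges over the coordinates of real^'n. *)
definition unit_pt :: "'n::finite option \<Rightarrow> real ^ 'n" where
  "unit_pt i = (case i of None \<Rightarrow> 0 | Some j \<Rightarrow> axis j 1)"

definition full_dimensional :: "'a::euclidean_space set \<Rightarrow> bool" where
  "full_dimensional S \<longleftrightarrow> aff_dim S = int DIM('a)"

(* R^(d+n) is the product space real^'d \<times> real^'n, of DIM equal to CARD('d) + CARD('n). *)
definition cayley_polytope ::
    "('n::finite option \<Rightarrow> (real ^ 'd::finite) set) \<Rightarrow> ((real ^ 'd) \<times> (real ^ 'n)) set" where
  "cayley_polytope P = convex hull (\<Union>i. {(x, unit_pt i) | x. x \<in> P i})"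

(* aff_dim is one less than the maximum number of affinely independent points. *)
lemma aff_dim_eq_Max_card:
  fixes S :: "'a::euclidean_space set"
  shows "aff_dim S = int (Max {card B | B. B \<subseteq> S \<and> \<not> affine_dependent B}) - 1"
proof -
  let ?C = "{card B | B. B \<subseteq> S \<and> \<not> affine_dependent B}"
  have le: "int m \<le> aff_dim S + 1" if m: "m \<in> ?C" for m
  proof -
    obtain B where B: "m = card B" "B \<subseteq> S" "\<not> affine_dependent B"
      using m by blast
    have "aff_dim B = int (card B) - 1"
      using aff_dim_affine_independent[OF B(3)] by simp
    with aff_dim_subset[OF B(2)] B(1) show ?thesis by simp
  qed
  obtain B where B: "B \<subseteq> S" "\<not> affine_dependent B" "affine hull S = affine hull B"
    using affine_basis_exists by metis
  have card_B: "int (card B) = aff_dim S + 1"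
    using aff_dim_unique[of B S] B by simp
  have "card B \<in> ?C"
    using B by blast
  moreover have bound: "m \<le> card B" if "m \<in> ?C" for m
    using le[OF that] card_B by simp
  moreover have "finite ?C"
    by (rule finite_subset[of _ "{..card B}"]) (use bound in auto)
  ultimately have "Max ?C = card B"
    by (intro Max_eqI)
  then show ?thesis
    using card_B by simp
qed

lemma polytope_cayley_polytope:
  assumes "\<And>i. polytope (P i)"
  shows "polytope (cayley_polytope P)"
proof -
  obtain F where F: "\<And>i. finite (F i)" "\<And>i. P i = convex hull F i"
    using assms unfolding polytope_def by metis
  have "{(x, unit_pt i) | x. x \<in> P i} = convex hull (F i \<times> {unit_pt i})" for i
    unfolding convex_hull_Times F(2) by auto
  then have "cayley_polytope P = convex hull (\<Union>i. convex hull (F i \<times> {unit_pt i}))"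
    unfolding cayley_polytope_def by (simp only:)
  also have "\<dots> = convex hull (\<Union>i. F i \<times> {unit_pt i})"
  proof (rule antisym)
    have sub: "convex hull (F i \<times> {unit_pt i}) \<subseteq> convex hull (\<Union>i. F i \<times> {unit_pt i})" for i
      by (rule hull_mono) blast
    show "convex hull (\<Union>i. convex hull (F i \<times> {unit_pt i}))
        \<subseteq> convex hull (\<Union>i. F i \<times> {unit_pt i})"
      by (rule hull_minimal, rule UN_least, rule sub, rule convex_convex_hull)
    show "convex hull (\<Union>i. F i \<times> {unit_pt i})
        \<subseteq> convex hull (\<Union>i. convex hull (F i \<times> {unit_pt i}))"
      by (rule hull_mono, rule UN_mono[OF subset_refl hull_subset])
  qed
  finally have "cayley_polytope P = convex hull (\<Union>i. F i \<times> {unit_pt i})" .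
  moreover have "finite (\<Union>i. F i \<times> {unit_pt i})"
    using F(1) by simp
  ultimately show ?thesis
    unfolding polytope_def by (intro exI conjI)
qed

end

theory Submission
  imports Defs
begin

text \<open>
  A set is full dimensional exactly if its affine hull is the whole space, so the object to study
  is the affine hull \<open>A\<close> of the polytope, which contains every \<open>P i \<times> {unit_pt i}\<close>.
  The full dimensional \<open>P k\<close> forces the entire fibre over \<open>unit_pt k\<close> into \<open>A\<close>
  (\<open>affine_fibre\<close>), so every vector \<open>(v, 0)\<close> is a direction of \<open>A\<close>.  Translating one
  point of each of the other, nonempty, sets along these directions yields the entire fibre over
  every \<open>unit_pt i\<close> (\<open>affine_translate_fibre\<close>).  The points over which \<open>A\<close> contains
  the entire fibre form an affine set (\<open>affine_full_fibres\<close>), and the \<open>unit_pt i\<close> affinely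
  span the second factor (\<open>affine_hull_range_unit_pt\<close>); hence \<open>A\<close> contains all fibres.
\<close>

lemma full_dimensional_iff_affine_hull:
  "full_dimensional S \<longleftrightarrow> affine hull S = UNIV"
  unfolding full_dimensional_def by (rule aff_dim_eq_full)

text \<open>The origin is among these points, so their affine hull is their linear span, and the
  remaining points are the standard basis.\<close>

lemma affine_hull_range_unit_pt:
  "affine hull range (unit_pt :: 'n::finite option \<Rightarrow> real ^ 'n) = UNIV"
proof -
  let ?R = "range (unit_pt :: 'n option \<Rightarrow> real ^ 'n)"
  have "unit_pt None \<in> ?R"
    by (rule rangeI)
  then have "0 \<in> affine hull ?R"
    by (metis (mono_tags) hull_inc option.simps(4) unit_pt_def)
  then have "affine hull ?R = span ?R"
    by (rule affine_hull_span_0)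
  moreover have "Basis \<subseteq> ?R"
  proof
    fix b :: "real ^ 'n"
    assume "b \<in> Basis"
    then obtain j where "b = axis j 1"
      by (auto simp: Basis_vec_def)
    then have "b = unit_pt (Some j)"
      by (simp add: unit_pt_def)
    then show "b \<in> ?R"
      by blast
  qed
  then have "span ?R = UNIV"
    using span_mono[of Basis ?R] by auto
  ultimately show ?thesis
    by simp
qed

lemma affine_fibre:
  fixes A :: "('a::real_vector \<times> 'b::real_vector) set"
  assumes "affine A"
  shows "affine {x. (x, z) \<in> A}"
  unfolding affine_def
proof clarify
  fix x y :: 'a and u v :: real
  assume "(x, z) \<in> A" "(y, z) \<in> A" and uv: "u + v = 1"
  then have "u *\<^sub>R (x, z) + v *\<^sub>R (y, z) \<in> A"
    by (rule mem_affine[OF \<open>affine A\<close>])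
  moreover have "u *\<^sub>R z + v *\<^sub>R z = z"
    using uv by (metis scaleR_add_left scaleR_one)
  ultimately show "(u *\<^sub>R x + v *\<^sub>R y, z) \<in> A"
    by simp
qed

text \<open>The displacement between two points of the full fibre over \<open>z\<close> is an arbitrary vector
  \<open>(v, 0)\<close>, and an affine set is invariant under translation by differences of its points.\<close>

lemma affine_translate_fibre:
  fixes A :: "('a::real_vector \<times> 'b::real_vector) set"
  assumes "affine A" and fibre: "\<And>x. (x, z) \<in> A" and "(y, w) \<in> A"
  shows "(x, w) \<in> A"
proof -
  have "(y, w) + 1 *\<^sub>R ((x - y, z) - (0, z)) \<in> A"
    by (rule mem_affine_3_minus[OF \<open>affine A\<close> \<open>(y, w) \<in> A\<close> fibre fibre])
  then show ?thesis
    by simp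
qed

text \<open>Over each fixed \<open>x\<close>, the condition on \<open>z\<close> cuts out the preimage of \<open>A\<close> under
  \<open>z \<mapsto> (x, z)\<close>, and affineness survives intersecting over all \<open>x\<close>.\<close>

lemma affine_full_fibres:
  fixes A :: "('a::real_vector \<times> 'b::real_vector) set"
  assumes "affine A"
  shows "affine {z. \<forall>x. (x, z) \<in> A}"
  unfolding affine_def
proof clarify
  fix z w :: 'b and u v :: real and x :: 'a
  assume z: "\<forall>x. (x, z) \<in> A" and w: "\<forall>x. (x, w) \<in> A" and uv: "u + v = 1"
  have "u *\<^sub>R (x, z) + v *\<^sub>R (x, w) \<in> A"
    using z w uv by (intro mem_affine[OF \<open>affine A\<close>]) auto
  moreover have "u *\<^sub>R x + v *\<^sub>R x = x"
    using uv by (metis scaleR_add_left scaleR_one)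
  ultimately show "(x, u *\<^sub>R z + v *\<^sub>R w) \<in> A"
    by simp
qed

theorem theorem2:
  fixes P :: "'n::finite option \<Rightarrow> (real ^ 'd::finite) set"
  assumes "\<And>i. polytope (P i)"
    and "\<And>i. P i \<noteq> {}"
    and "\<exists>i. full_dimensional (P i)"
  shows "full_dimensional (cayley_polytope P)"
proof -
  define A where "A = affine hull cayley_polytope P"
  have "affine A"
    unfolding A_def by (rule affine_affine_hull)
  have lifted: "(x, unit_pt i) \<in> A" if "x \<in> P i" for x i
    unfolding A_def cayley_polytope_def using that by (intro hull_inc) blast
  obtain k where "full_dimensional (P k)"
    using assms(3) by blast
  then have hull_k: "affine hull P k = UNIV"
    by (simp add: full_dimensional_iff_affine_hull)
  have "affine hull P k \<subseteq> {x. (x, unit_pt k) \<in> A}"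
    using lifted by (intro hull_minimal affine_fibre \<open>affine A\<close>) auto
  then have fibre_k: "(x, unit_pt k) \<in> A" for x
    using hull_k by blast
  have "(x, unit_pt i) \<in> A" for x i
  proof -
    obtain y where "y \<in> P i"
      using assms(2) by blast
    then show ?thesis
      using affine_translate_fibre[OF \<open>affine A\<close> fibre_k lifted] by blast
  qed
  then have "affine hull range unit_pt \<subseteq> {z. \<forall>x. (x, z) \<in> A}"
    by (intro hull_minimal affine_full_fibres \<open>affine A\<close>) auto
  then have "A = UNIV"
    unfolding affine_hull_range_unit_pt by auto
  then show ?thesis
    by (simp add: full_dimensional_iff_affine_hull A_def)
qed

end
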